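(* For all integers $n, m$ with $2 \le m \le n$, $$a(n,m)=\frac{m-1}{n-1}\binom{2n-m-2}{n-2},$$ where $a(n,m)$ is the number of words in $\mathcal{L}_n$ that contain exactly $m$ zeros.
   Context: For a positive integer $n$, $\mathcal{L}_n$ denotes the set of all words $a=(a_1,a_2,\ldots,a_n)$ over the alphabet of non-negative integers satisfying: (i) $a_{i+1}\ge a_i-1$ for $1\le i<n$; and (ii) if $a_i=k>0$ with $i$ minimal (i.e. $i$ is the position of the left-most occurrence of the letter $k$), then there exist $i_1<i<i_2$ such that $a_{i_1}=a_{i_2}=k-1$. *)

theory Defs
  imports Complex_Main
begin

(* Words of length n are lists of naturals, with positions 0, ..., n - 1.
   The first condition is a_(i+1) >= a_i - 1 over the integers. *)
definition words :: "nat \<Rightarrow> nat list set" where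
  "words n = {a. length a = n \<and>
     (\<forall>i. Suc i < n \<longrightarrow> int (a ! Suc i) \<ge> int (a ! i) - 1) \<and>
     (\<forall>i<n. a ! i > 0 \<and> (\<forall>j<i. a ! j \<noteq> a ! i) \<longrightarrow>
        (\<exists>i1 i2. i1 < i \<and> i < i2 \<and> i2 < n \<and> a ! i1 = a ! i - 1 \<and> a ! i2 = a ! i - 1))}"

definition num_words :: "nat \<Rightarrow> nat \<Rightarrow> nat" where
  "num_words n m = card {a \<in> words n. count_list a 0 = m}"

end

theory Submission
  imports Defs
begin

text \<open>
  Erase the zeros of a word \<open>a\<close> of length \<open>n\<close> with \<open>m\<close> zeros, \<open>1 \<le> m < n\<close>, and lower the
  remaining letters by one. The result \<open>b\<close> is again a word of the family, of length
  \<open>n - m\<close>. Conversely, \<open>a\<close> is rebuilt from \<open>b\<close> by inserting zeros into \<open>map Suc b\<close>. By the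
  descent condition a zero may only stand at the front, after another zero or after a one; and \<open>a\<close>
  must begin with zero. If \<open>b\<close> has \<open>j\<close> zeros, this leaves \<open>m - 1\<close> zeros to be distributed
  freely over \<open>j + 1\<close> slots (the front and the place behind each of the \<open>j\<close> ones). The
  only distribution to be excluded puts all zeros at the front, since the leftmost one also needs
  a zero to its right. With \<open>a(n, m)\<close> for the number of words this gives
  (\<open>num_words_peel_zeros\<close>)
  \<open>a(n, m) = (\<Sum>j. a(n - m, j) * ((m - 1 + j choose m - 1) - 1))\<close>.

  Together with \<open>a(n, n) = 1\<close> this determines all the numbers, but it is far from the closed form. By induction on \<open>n\<close>
  it implies the recurrence of the ballot numbers (\<open>num_words_recurrence\<close>),
  \<open>a(n, m) = a(n, m + 1) + a(n - 1, m - 1)\<close>: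
  in the difference \<open>a(n, m) - a(n - 1, m - 1)\<close> both terms refer to words of the same length
  \<open>n - m\<close>, and Pascal's rule simplifies the coefficients, while \<open>a(n, m + 1)\<close> refers to words of
  length \<open>n - m - 1\<close>; the recurrence for length \<open>n - m\<close> and a summation by parts turn one sum
  into the other. The recurrence is solved by a difference of two binomial coefficients
  (\<open>num_words_ballot\<close>), which the absorption identities bring into the product form.
\<close>

section \<open>Words described by list operations\<close>

abbreviation slow_descent :: "nat list \<Rightarrow> bool" where
  "slow_descent \<equiv> successively (\<lambda>x y. x \<le> Suc y)"

text \<open>
  The requirement on the leftmost occurrence of the letter \<open>k + 1\<close>. Splitting the list at the leftmost \<open>Suc k\<close> instead
  of quantifying over positions makes the condition commute with filtering and mapping. The second
  list starts with that occurrence itself, which does no harm as \<open>Suc k \<noteq> k\<close>.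
\<close>

definition flanked :: "nat \<Rightarrow> nat list \<Rightarrow> bool" where
  "flanked k a \<longleftrightarrow> (Suc k \<in> set a \<longrightarrow>
     k \<in> set (takeWhile (\<lambda>x. x \<noteq> Suc k) a) \<and> k \<in> set (dropWhile (\<lambda>x. x \<noteq> Suc k) a))"

lemma flanked_all_conv_nth:
  "(\<forall>k. flanked k a) \<longleftrightarrow>
     (\<forall>i<length a. a ! i > 0 \<and> (\<forall>j<i. a ! j \<noteq> a ! i) \<longrightarrow>
        (\<exists>i1 i2. i1 < i \<and> i < i2 \<and> i2 < length a \<and> a ! i1 = a ! i - 1 \<and> a ! i2 = a ! i - 1))"
    (is "?L \<longleftrightarrow> ?R")
proof
  assume L: ?L
  show ?R
  proof (intro allI impI)
    fix i assume i: "i < length a" and fst: "a ! i > 0 \<and> (\<forall>j<i. a ! j \<noteq> a ! i)"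
    then obtain k where k: "a ! i = Suc k" using not0_implies_Suc by blast
    have tw: "takeWhile (\<lambda>x. x \<noteq> Suc k) a = take i a"
      by (rule takeWhile_eq_take_P_nth) (use i fst k in auto)
    have dw: "dropWhile (\<lambda>x. x \<noteq> Suc k) a = drop i a"
      by (metis dropWhile_eq_drop tw i length_take min.absorb2 less_imp_le)
    have "Suc k \<in> set a" using i k nth_mem by metis
    then have in1: "k \<in> set (take i a)" and in2: "k \<in> set (drop i a)"
      using L tw dw unfolding flanked_def by metis+
    obtain i1 where i1: "i1 < i" "a ! i1 = k" using in1 by (auto simp: in_set_conv_nth)
    obtain d where d: "d < length a - i" "a ! (i + d) = k"
      using in2 i by (auto simp: in_set_conv_nth)
    have "d \<noteq> 0" using d k by (intro notI) auto
    then show "\<exists>i1 i2. i1 < i \<and> i < i2 \<and> i2 < length a \<and> a ! i1 = a ! i - 1 \<and> a ! i2 = a ! i - 1"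
      using i1 d k by (intro exI[of _ i1] exI[of _ "i + d"]) auto
  qed
next
  assume R: ?R
  show ?L
    unfolding flanked_def
  proof (intro allI impI)
    fix k assume mem: "Suc k \<in> set a"
    define i where "i = length (takeWhile (\<lambda>x. x \<noteq> Suc k) a)"
    have i: "i < length a"
      using mem unfolding i_def by (induction a) auto
    have ai: "a ! i = Suc k"
      using nth_length_takeWhile[of "\<lambda>x. x \<noteq> Suc k" a] i unfolding i_def by auto
    have before: "a ! j \<noteq> Suc k" if "j < i" for j
      using that set_takeWhileD[OF nth_mem[of j "takeWhile (\<lambda>x. x \<noteq> Suc k) a"]]
      unfolding i_def by (metis takeWhile_nth)
    obtain i1 i2 where I: "i1 < i" "i < i2" "i2 < length a" "a ! i1 = k" "a ! i2 = k"
      using R[rule_format, OF i] ai before by auto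
    have "k \<in> set (takeWhile (\<lambda>x. x \<noteq> Suc k) a)"
      using I(1,4) unfolding i_def by (metis nth_mem takeWhile_nth)
    moreover have "dropWhile (\<lambda>x. x \<noteq> Suc k) a = drop i a"
      unfolding i_def by (rule dropWhile_eq_drop)
    then have "k \<in> set (dropWhile (\<lambda>x. x \<noteq> Suc k) a)"
      using I by (auto simp: in_set_conv_nth intro!: exI[of _ "i2 - i"])
    ultimately show "k \<in> set (takeWhile (\<lambda>x. x \<noteq> Suc k) a) \<and> k \<in> set (dropWhile (\<lambda>x. x \<noteq> Suc k) a)"
      by blast
  qed
qed

lemma words_iff:
  "a \<in> words n \<longleftrightarrow> length a = n \<and> slow_descent a \<and> (\<forall>k. flanked k a)"
proof -
  have "slow_descent a \<longleftrightarrow> (\<forall>i. Suc i < length a \<longrightarrow> int (a ! Suc i) \<ge> int (a ! i) - 1)"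
    by (auto simp: successively_conv_nth)
  then show ?thesis
    unfolding words_def flanked_all_conv_nth by auto
qed

lemma words_starts_with_zero:
  assumes "a \<in> words n" "n > 0"
  obtains w where "a = 0 # w"
proof (cases a)
  case Nil
  then show ?thesis using assms by (simp add: words_iff)
next
  case (Cons x w)
  have "x = 0"
  proof (rule ccontr)
    assume "x \<noteq> 0"
    then obtain k where "x = Suc k" using not0_implies_Suc by blast
    moreover have "flanked k a" using assms by (simp add: words_iff)
    ultimately show False using Cons by (simp add: flanked_def)
  qed
  then show ?thesis using Cons that by blast
qed

text \<open>
  Flanking makes the set of letters closed downwards, so a word of length \<open>n\<close> has no room
  for a letter above \<open>n\<close>.
\<close>

lemma finite_words: "finite (words n)"
proof (rule finite_subset)
  show "words n \<subseteq> {a. set a \<subseteq> {..n} \<and> length a = n}"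
  proof
    fix a assume a: "a \<in> words n"
    have "x \<in> set a \<Longrightarrow> {..x} \<subseteq> set a" for x
    proof (induction x)
      case (Suc x)
      have "flanked x a" using a by (simp add: words_iff)
      then have "x \<in> set a" using Suc.prems set_takeWhileD unfolding flanked_def by metis
      then show ?case using Suc by (auto simp: atMost_Suc)
    qed simp
    then have "x \<le> n" if "x \<in> set a" for x
      using card_mono[of "set a" "{..x}"] card_length[of a] that a
      by (fastforce simp: words_iff)
    then show "a \<in> {a. set a \<subseteq> {..n} \<and> length a = n}"
      using a by (auto simp: words_iff)
  qed
qed (simp add: finite_lists_length_eq)

section \<open>Erasing the zeros\<close>

text \<open>
  Zeros are irrelevant to the flanking of letters from 2 on, since \<open>takeWhile\<close> and
  \<open>dropWhile\<close> up to a positive letter commute with erasing them.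
\<close>

lemma flanked_Suc_iff:
  assumes "filter (\<lambda>x. x \<noteq> 0) a = map Suc b"
  shows "flanked (Suc k) a \<longleftrightarrow> flanked k b"
proof -
  have tw: "takeWhile (\<lambda>x. x \<noteq> Suc y) (filter (\<lambda>x. x \<noteq> 0) a)
      = filter (\<lambda>x. x \<noteq> 0) (takeWhile (\<lambda>x. x \<noteq> Suc y) a)" for y
    by (induction a) auto
  have dw: "dropWhile (\<lambda>x. x \<noteq> Suc y) (filter (\<lambda>x. x \<noteq> 0) a)
      = filter (\<lambda>x. x \<noteq> 0) (dropWhile (\<lambda>x. x \<noteq> Suc y) a)" for y
    by (induction a) auto
  have mem: "Suc y \<in> set xs \<longleftrightarrow> Suc y \<in> set (filter (\<lambda>x. x \<noteq> 0) xs)" for y and xs :: "nat list"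
    by simp
  have "flanked (Suc k) a \<longleftrightarrow> flanked (Suc k) (map Suc b)"
    unfolding flanked_def assms[symmetric] tw dw using mem by blast
  also have "\<dots> \<longleftrightarrow> flanked k b"
    unfolding flanked_def by (simp add: takeWhile_map dropWhile_map comp_def inj_image_mem_iff)
  finally show ?thesis .
qed

text \<open>
  A block of zeros can only follow a letter that is at most 1, and such a letter may be followed by
  anything; hence erasing the block never creates a steep descent.
\<close>

lemma slow_descent_filter_nonzero:
  "slow_descent (p # a) \<Longrightarrow> slow_descent (p # filter (\<lambda>x. x \<noteq> 0) a)"
proof (induction a arbitrary: p)
  case (Cons x a)
  show ?case
  proof (cases "x = 0")
    case True
    then have "p \<le> 1" "slow_descent (0 # filter (\<lambda>x. x \<noteq> 0) a)"
      using Cons by auto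
    then show ?thesis using True by (auto simp: successively_Cons)
  next
    case False
    then show ?thesis using Cons by auto
  qed
qed simp

text \<open>
  Everything before the leftmost 1 consists of zeros when 1 is the first nonzero letter, so no zero
  lies to the right of it exactly if all of them form the initial block.
\<close>

lemma zero_after_first_one_iff:
  fixes w :: "nat list"
  assumes "filter (\<lambda>x. x \<noteq> 0) w = 1 # c"
  shows "0 \<in> set (dropWhile (\<lambda>x. x \<noteq> 1) w) \<longleftrightarrow> w \<noteq> replicate (count_list w 0) 0 @ 1 # c"
  using assms
proof (induction w)
  case (Cons x w)
  show ?case
  proof (cases "x = 0")
    case True
    then have "filter (\<lambda>x. x \<noteq> 0) w = 1 # c" using Cons.prems by simp
    note Cons.IH[OF this]
    moreover have "0 \<in> set (dropWhile (\<lambda>x. x \<noteq> 1) (x # w)) \<longleftrightarrow> 0 \<in> set (dropWhile (\<lambda>x. x \<noteq> 1) w)"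
      using True by simp
    moreover have "x # w = replicate (count_list (x # w) 0) 0 @ 1 # c \<longleftrightarrow>
        w = replicate (count_list w 0) 0 @ 1 # c"
      using True by simp
    ultimately show ?thesis by simp
  next
    case False
    then have x: "x = 1" and c: "filter (\<lambda>x. x \<noteq> 0) w = c" using Cons.prems by auto
    show ?thesis
    proof (cases "0 \<in> set w")
      case True
      then have "count_list w 0 \<noteq> 0" by (simp add: count_list_0_iff)
      then obtain z where "count_list w 0 = Suc z" using not0_implies_Suc by blast
      then show ?thesis using True x by simp
    next
      case False
      then have "count_list w 0 = 0" by (simp add: count_list_0_iff)
      moreover have "filter (\<lambda>x. x \<noteq> 0) w = w" using False by (intro filter_True) metis
      then have "w = c" using c by simp
      ultimately show ?thesis using False x by simp
    qed
  qed
qed simp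

text \<open>
  Membership in the family splits into membership of the reduced word \<open>b\<close>, admissible places for
  the zeros, and the flanking of the leftmost 1. The left flank is the initial zero; the right flank
  is missing only if all zeros stand in front. A nonempty \<open>b\<close> starts with 0, so 1 is indeed
  the first nonzero letter of \<open>w\<close>.
\<close>

lemma zero_Cons_in_words_iff:
  assumes w: "filter (\<lambda>x. x \<noteq> 0) w = map Suc b"
  shows "0 # w \<in> words (Suc l) \<longleftrightarrow>
    length w = l \<and> slow_descent (0 # w) \<and> b \<in> words (length b) \<and>
    (b = [] \<or> w \<noteq> replicate (count_list w 0) 0 @ map Suc b)"
proof -
  have sh: "flanked (Suc k) (0 # w) \<longleftrightarrow> flanked k b" for k
    by (rule flanked_Suc_iff) (use w in simp)
  have all: "(\<forall>k. flanked k (0 # w)) \<longleftrightarrow> flanked 0 (0 # w) \<and> (\<forall>k. flanked k b)"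
    unfolding sh[symmetric] by (metis not0_implies_Suc)
  have desc: "slow_descent b" if "slow_descent (0 # w)"
    using slow_descent_filter_nonzero[OF that] unfolding w
    by (cases b) (auto simp: successively_Cons successively_map hd_map)
  define all_in_front where "all_in_front \<longleftrightarrow> w = replicate (count_list w 0) 0 @ map Suc b"
  have zero: "flanked 0 (0 # w) \<longleftrightarrow> b = [] \<or> \<not> all_in_front"
    if b: "b \<in> words (length b)"
  proof (cases "b = []")
    case True
    then have "1 \<notin> set w" using w by (auto simp: filter_empty_conv)
    then show ?thesis using True by (simp add: flanked_def)
  next
    case False
    then obtain b' where b': "b = 0 # b'"
      using words_starts_with_zero[OF b] by auto
    have c: "map Suc b = 1 # map Suc b'" unfolding b' by simp
    have "1 \<in> set (filter (\<lambda>x. x \<noteq> 0) w)" unfolding w c by simp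
    then have "flanked 0 (0 # w) \<longleftrightarrow> 0 \<in> set (dropWhile (\<lambda>x. x \<noteq> 1) w)"
      by (simp add: flanked_def)
    also have "\<dots> \<longleftrightarrow> \<not> all_in_front"
      unfolding all_in_front_def c by (rule zero_after_first_one_iff) (rule w[unfolded c])
    finally show ?thesis using False by blast
  qed
  have "0 # w \<in> words (Suc l) \<longleftrightarrow>
      length w = l \<and> slow_descent (0 # w) \<and> flanked 0 (0 # w) \<and> (\<forall>k. flanked k b)"
    unfolding words_iff all by simp
  moreover have "b \<in> words (length b) \<longleftrightarrow> slow_descent b \<and> (\<forall>k. flanked k b)"
    unfolding words_iff by simp
  ultimately show ?thesis unfolding all_in_front_def[symmetric] using desc zero by blast
qed

section \<open>Counting the insertions of zeros\<close>

text \<open>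
  The parameter \<open>p\<close> is the letter immediately in front of the list. It decides whether the list may
  start with a zero, which lets the recursion proceed letter by letter.
\<close>

definition zero_insertions :: "nat \<Rightarrow> nat \<Rightarrow> nat list \<Rightarrow> nat list set" where
  "zero_insertions p s c =
     {w. slow_descent (p # w) \<and> filter (\<lambda>x. x \<noteq> 0) w = c \<and> count_list w 0 = s}"

lemma zero_insertions_Nil:
  "zero_insertions p s [] = (if s = 0 \<or> p \<le> 1 then {replicate s 0} else {})"
proof -
  have eq: "filter (\<lambda>x. x \<noteq> 0) w = [] \<and> count_list w 0 = s \<longleftrightarrow> w = replicate s 0" for w :: "nat list"
  proof
    show "filter (\<lambda>x. x \<noteq> 0) w = [] \<and> count_list w 0 = s \<Longrightarrow> w = replicate s 0"
      by (induction w arbitrary: s) (auto split: if_splits)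
    show "w = replicate s 0 \<Longrightarrow> filter (\<lambda>x. x \<noteq> 0) w = [] \<and> count_list w 0 = s"
      by (induction s arbitrary: w) auto
  qed
  have desc: "slow_descent (replicate t 0)" for t
    by (auto simp: successively_conv_nth)
  show ?thesis
    unfolding zero_insertions_def eq using desc[of s]
    by (cases s) (auto simp: successively_Cons)
qed

lemma zero_insertions_Cons:
  assumes "x \<noteq> 0" "p \<le> Suc x"
  shows "zero_insertions p s (x # c) =
    (if s > 0 \<and> p \<le> 1 then (#) 0 ` zero_insertions 0 (s - 1) (x # c) else {})
      \<union> (#) x ` zero_insertions x s c"
proof (rule set_eqI)
  fix w
  show "w \<in> zero_insertions p s (x # c) \<longleftrightarrow> w \<in> (if s > 0 \<and> p \<le> 1
      then (#) 0 ` zero_insertions 0 (s - 1) (x # c) else {}) \<union> (#) x ` zero_insertions x s c"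
    using assms by (cases w) (auto simp: zero_insertions_def)
qed

lemma length_eq_zeros_plus_nonzeros:
  "length w = count_list w 0 + length (filter (\<lambda>x. x \<noteq> 0) w)" for w :: "nat list"
  by (induction w) auto

lemma count_list_replicate_same: "count_list (replicate n x) x = n"
  by (induction n) auto

lemma finite_zero_insertions: "finite (zero_insertions p s c)"
proof (rule finite_subset)
  show "zero_insertions p s c \<subseteq> {w. set w \<subseteq> insert 0 (set c) \<and> length w = s + length c}"
  proof
    fix w assume w: "w \<in> zero_insertions p s c"
    then have "length w = s + length c"
      using length_eq_zeros_plus_nonzeros[of w] by (auto simp: zero_insertions_def)
    then show "w \<in> {w. set w \<subseteq> insert 0 (set c) \<and> length w = s + length c}"
      using w by (auto simp: zero_insertions_def)
  qed
qed (simp add: finite_lists_length_eq)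

text \<open>
  Zeros can be placed exactly behind the letters that are at most 1, so this is the number of
  multisets of size \<open>s\<close> over these slots; \<open>p\<close> contributes a slot if it is at most 1. In the
  recursion, either a zero is put into the first slot, or that slot is closed: Pascal's rule.
  Without any slot, truncated subtraction gives \<open>s - 1 choose s\<close>, which is 1 for \<open>s = 0\<close> and 0
  otherwise, as it should be.
\<close>

lemma card_zero_insertions:
  assumes "slow_descent (p # c)" "0 \<notin> set c"
  shows "card (zero_insertions p s c) = (s + length (filter (\<lambda>x. x \<le> 1) (p # c)) - 1) choose s"
  using assms
proof (induction c arbitrary: p s)
  case Nil
  then show ?case by (auto simp: zero_insertions_Nil)
next
  case (Cons x c)
  define k where "k = length (filter (\<lambda>x. x \<le> 1) (x # c))"
  have x: "x \<noteq> 0" "slow_descent (x # c)" "0 \<notin> set c" using Cons.prems by auto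
  have tail: "card ((#) x ` zero_insertions x t c) = (t + k - 1) choose t" for t
    using Cons.IH[OF x(2,3)] by (simp add: card_image k_def)
  have disj: "(#) 0 ` A \<inter> (#) x ` B = {}" for A B using x by auto
  \<comment> \<open>If \<open>p\<close> offers a slot, one zero at a time is put into it; afterwards the preceding letter is 0,
    which offers a slot again.\<close>
  have low: "card (zero_insertions p t (x # c)) = (t + k) choose t" if "p \<le> 1" for p t
    using that
  proof (induction t arbitrary: p)
    case 0
    then show ?case using x tail[of 0] by (simp add: zero_insertions_Cons)
  next
    case (Suc t)
    then have "card (zero_insertions p (Suc t) (x # c))
        = card (zero_insertions 0 t (x # c)) + card ((#) x ` zero_insertions x (Suc t) c)"
      using x by (subst zero_insertions_Cons)
        (auto simp: card_Un_disjoint disj finite_zero_insertions card_image)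
    also have "\<dots> = (t + k choose t) + (t + k choose Suc t)"
      using Suc.IH[of 0] tail[of "Suc t"] by simp
    finally show ?case by simp
  qed
  show ?case
  proof (cases "p \<le> 1")
    case True
    then show ?thesis using low[OF True] by (simp add: k_def)
  next
    case False
    then show ?thesis using x tail Cons.prems
      by (simp add: zero_insertions_Cons k_def)
  qed
qed

lemma card_proper_insertions:
  assumes b: "b \<in> words N" and "N > 0"
  shows "int (card (zero_insertions 0 s (map Suc b) - {replicate s 0 @ map Suc b}))
    = int ((s + count_list b 0) choose s) - 1"
proof -
  have desc: "slow_descent (0 # map Suc b)"
    using b by (auto simp: words_iff successively_Cons successively_map)
  have "slow_descent (0 # replicate s 0 @ map Suc b)"
    using desc by (induction s) auto
  then have mem: "replicate s 0 @ map Suc b \<in> zero_insertions 0 s (map Suc b)"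
    by (auto simp: zero_insertions_def count_list_0_iff filter_map comp_def
        count_list_replicate_same)
  have "length (filter (\<lambda>x. x \<le> 1) (0 # map Suc b)) = Suc (count_list b 0)"
    by (induction b) auto
  then have c: "card (zero_insertions 0 s (map Suc b)) = (s + count_list b 0) choose s"
    using card_zero_insertions[OF desc, of s] by auto
  have "card (zero_insertions 0 s (map Suc b)) > 0"
    using mem finite_zero_insertions card_gt_0_iff by blast
  moreover have "card (zero_insertions 0 s (map Suc b) - {replicate s 0 @ map Suc b})
      = card (zero_insertions 0 s (map Suc b)) - 1"
    using mem by (rule card_Diff_singleton)
  ultimately show ?thesis unfolding c by linarith
qed


section \<open>The sum relation between the counts\<close>

lemma words_by_zeros_decomposition:
  assumes "Suc s < n"
  shows "{a \<in> words n. count_list a 0 = Suc s} =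
    (\<Union>b\<in>words (n - Suc s). (#) 0 ` (zero_insertions 0 s (map Suc b) - {replicate s 0 @ map Suc b}))"
    (is "?A = ?B")
proof (intro set_eqI iffI)
  fix a assume a: "a \<in> ?A"
  then obtain w where w: "a = 0 # w" using assms words_starts_with_zero[of a n] by auto
  define b where "b = map (\<lambda>x. x - 1) (filter (\<lambda>x. x \<noteq> 0) w)"
  have f: "filter (\<lambda>x. x \<noteq> 0) w = map Suc b"
    unfolding b_def by (auto simp: comp_def intro!: map_idI[symmetric])
  have s: "count_list w 0 = s" using a w by simp
  obtain l where l: "n = Suc l" using assms by (cases n) auto
  have len: "length w = count_list w 0 + length b"
    using length_eq_zeros_plus_nonzeros[of w] f by simp
  have iff: "length w = l \<and> slow_descent (0 # w) \<and> b \<in> words (length b) \<and>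
    (b = [] \<or> w \<noteq> replicate (count_list w 0) 0 @ map Suc b)"
    using a unfolding w l zero_Cons_in_words_iff[OF f, symmetric] by simp
  then have lb: "length b = n - Suc s" using iff[THEN conjunct1] len l s by linarith
  then have "b \<noteq> []" using assms by auto
  then have "w \<in> zero_insertions 0 s (map Suc b) - {replicate s 0 @ map Suc b}"
    using iff[unfolded s] f s unfolding zero_insertions_def by blast
  moreover have "b \<in> words (n - Suc s)" using iff lb by simp
  ultimately show "a \<in> ?B" using w by blast
next
  fix a assume "a \<in> ?B"
  then obtain b w where a: "a = 0 # w" and b: "b \<in> words (n - Suc s)"
    and w: "w \<in> zero_insertions 0 s (map Suc b)" "w \<noteq> replicate s 0 @ map Suc b" by blast
  have f: "filter (\<lambda>x. x \<noteq> 0) w = map Suc b" and s: "count_list w 0 = s"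
    and d: "slow_descent (0 # w)" using w(1) by (simp_all add: zero_insertions_def)
  have lb: "length b = n - Suc s" using b by (simp add: words_iff)
  have "length w = count_list w 0 + length (map Suc b)"
    using length_eq_zeros_plus_nonzeros[of w] f by simp
  then have len: "n = Suc (length w)" using lb s assms by simp
  have "b \<in> words (length b)" using b lb by simp
  then have "a \<in> words n"
    unfolding a len zero_Cons_in_words_iff[OF f] s using d w(2) by blast
  then show "a \<in> ?A" using a s by simp
qed

lemma num_words_eq_0_of_gt: "n < m \<Longrightarrow> num_words n m = 0"
proof -
  assume "n < m"
  then have "count_list a 0 \<noteq> m" if "a \<in> words n" for a
    using count_le_length[of a 0] that by (auto simp: words_iff)
  then have "{a \<in> words n. count_list a 0 = m} = {}" by blast
  then show ?thesis unfolding num_words_def by (simp only: card.empty)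
qed

lemma num_words_all_zeros: "num_words n n = 1"
proof -
  have zeros: "replicate n 0 \<in> words n"
    by (auto simp: words_def)
  have unique: "a = replicate n 0" if "length a = n" "count_list a 0 = n" for a :: "nat list"
  proof -
    have "length (filter (\<lambda>x. x \<noteq> 0) a) = 0"
      using length_eq_zeros_plus_nonzeros[of a] that by linarith
    then have "\<forall>x\<in>set a. x = 0" by (simp add: filter_empty_conv)
    then show ?thesis using that(1) replicate_eqI by metis
  qed
  have "{a \<in> words n. count_list a 0 = n} = {replicate n 0}"
  proof (intro equalityI subsetI)
    fix a assume "a \<in> {a \<in> words n. count_list a 0 = n}"
    then have "length a = n" "count_list a 0 = n" by (simp_all add: words_iff)
    then show "a \<in> {replicate n 0}" using unique by blast
  qed (simp add: zeros count_list_replicate_same)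
  then show ?thesis unfolding num_words_def by simp
qed

lemma sum_over_words_by_zeros:
  fixes f :: "nat \<Rightarrow> int"
  shows "(\<Sum>b\<in>words n. f (count_list b 0)) = (\<Sum>j\<le>n. int (num_words n j) * f j)"
proof -
  have "(\<Sum>b\<in>words n. f (count_list b 0))
      = (\<Sum>j\<le>n. \<Sum>b\<in>{b \<in> words n. count_list b 0 = j}. f (count_list b 0))"
    using count_le_length[of _ "0::nat"]
    by (intro sum.group[symmetric]) (auto simp: finite_words words_iff)
  then show ?thesis by (simp add: num_words_def)
qed

text \<open>
  The subtracted 1 accounts for the single insertion with all zeros at the front. For a nonempty
  reduced word it always violates the flanking of the leftmost 1, hence \<open>Suc s < n\<close>.
\<close>

lemma num_words_peel_zeros:
  assumes "Suc s < n"
  shows "int (num_words n (Suc s)) =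
    (\<Sum>j\<le>n - Suc s. int (num_words (n - Suc s) j) * (int ((s + j) choose s) - 1))"
proof -
  define ins where "ins b = zero_insertions 0 s (map Suc b) - {replicate s 0 @ map Suc b}" for b
  have "int (num_words n (Suc s)) = int (card (\<Union>b\<in>words (n - Suc s). (#) 0 ` ins b))"
    unfolding num_words_def words_by_zeros_decomposition[OF assms] ins_def ..
  also have "\<dots> = (\<Sum>b\<in>words (n - Suc s). int (card (ins b)))"
  proof (subst card_UN_disjoint)
    show "\<forall>b\<in>words (n - Suc s). \<forall>c\<in>words (n - Suc s).
        b \<noteq> c \<longrightarrow> (#) 0 ` ins b \<inter> (#) 0 ` ins c = {}"
      by (auto simp: ins_def zero_insertions_def inj_map_eq_map)
  qed (auto simp: finite_words ins_def finite_zero_insertions card_image)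
  also have "\<dots> = (\<Sum>b\<in>words (n - Suc s). int ((s + count_list b 0) choose s) - 1)"
    using assms by (intro sum.cong) (auto simp: ins_def card_proper_insertions)
  finally show ?thesis
    using sum_over_words_by_zeros[of "\<lambda>j. int ((s + j) choose s) - 1"] by simp
qed

lemma num_words_single_zero: "1 < n \<Longrightarrow> num_words n 1 = 0"
  using num_words_peel_zeros[of 0 n] by simp

section \<open>The ballot recurrence\<close>

lemma summation_by_parts:
  fixes f g :: "nat \<Rightarrow> 'a :: comm_ring"
  shows "(\<Sum>i\<le>K. (f i - f (Suc i)) * g i)
    = (\<Sum>i<K. f (Suc i) * (g (Suc i) - g i)) + f 0 * g 0 - f (Suc K) * g K"
  by (induction K) (simp_all add: algebra_simps)

text \<open>
  The claim for \<open>m < n\<close> follows from the claim for the smaller length \<open>N = n - m\<close>. The latter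
  expresses \<open>a(N - 1, i)\<close> as \<open>a(N, i + 1) - a(N, i + 2)\<close>, so the sum for \<open>a(n, m + 1)\<close>, whose
  terms count words of length \<open>N - 1\<close>, becomes one over counts of words of length \<open>N\<close>.
\<close>

lemma num_words_recurrence:
  assumes "2 \<le> n" "2 \<le> m"
  shows "num_words n m = num_words n (Suc m) + num_words (n - 1) (m - 1)"
  using assms
proof (induction n arbitrary: m rule: less_induct)
  case (less n)
  consider "m > n" | "m = n" | "m < n" by linarith
  then show ?case
  proof cases
    case 1
    then show ?thesis using less.prems by (simp add: num_words_eq_0_of_gt)
  next
    case 2
    then show ?thesis by (simp add: num_words_eq_0_of_gt num_words_all_zeros)
  next
    case 3
    obtain t where t: "m = Suc (Suc t)"
      using less.prems by (metis Suc_le_D numeral_2_eq_2 Suc_le_mono)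
    define N where "N = n - m"
    have N: "N \<ge> 1" "n - Suc (Suc t) = N" "n - 1 - Suc t = N" using 3 t by (auto simp: N_def)
    have "int (num_words n m) - int (num_words (n - 1) (m - 1))
        = (\<Sum>j\<le>N. int (num_words N j) * (int ((Suc t + j) choose Suc t) - 1))
        - (\<Sum>j\<le>N. int (num_words N j) * (int ((t + j) choose t) - 1))"
      using num_words_peel_zeros[of "Suc t" n] num_words_peel_zeros[of t "n - 1"] 3
      unfolding t N by simp
    also have "\<dots> = (\<Sum>j\<le>N. int (num_words N j) * int ((t + j) choose Suc t))"
      unfolding sum_subtractf[symmetric] by (intro sum.cong) (auto simp: algebra_simps)
    also have "\<dots> = int (num_words n (Suc m))"
    proof (cases "N = 1")
      case True
      then have "Suc m = n" using 3 by (simp add: N_def)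
      then have "num_words n (Suc m) = 1" by (simp add: num_words_all_zeros)
      then show ?thesis
        using True num_words_all_zeros[of 1] by simp
    next
      case False
      then obtain K where K: "N = Suc (Suc K)"
        using N(1) by (metis One_nat_def not0_implies_Suc not_one_le_zero)
      define g where "g i = int ((Suc (Suc t) + i) choose Suc (Suc t)) - 1" for i
      have "N - 1 = Suc K" using K by simp
      then have IH: "num_words N (Suc i) = num_words N (Suc (Suc i)) + num_words (Suc K) i" if "i > 0" for i
        using less.IH[of N "Suc i"] that 3 K less.prems unfolding N_def by simp
      \<comment> \<open>The induction hypothesis fails for \<open>i = 0\<close>, where it would concern words with one zero;
        there the weight \<open>g 0 = 0\<close> makes both sides vanish.\<close>
      have step: "int (num_words (Suc K) i) * g i
          = (int (num_words N (Suc i)) - int (num_words N (Suc (Suc i)))) * g i" for i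
        by (cases "i = 0") (simp_all add: g_def IH[of i])
      have "int (num_words n (Suc m)) = (\<Sum>i\<le>Suc K. int (num_words (Suc K) i) * g i)"
      proof -
        have "n - Suc (Suc (Suc t)) = Suc K" "Suc (Suc (Suc t)) < n"
          using N(2) K by linarith+
        then show ?thesis
          using num_words_peel_zeros[of "Suc (Suc t)" n] unfolding t g_def by simp
      qed
      also have "\<dots> = (\<Sum>i\<le>Suc K. (int (num_words N (Suc i)) - int (num_words N (Suc (Suc i)))) * g i)"
        unfolding step ..
      also have "\<dots> = (\<Sum>i\<le>K. int (num_words N (Suc (Suc i))) * (g (Suc i) - g i))"
      proof -
        have "g 0 = 0" "num_words N (Suc (Suc (Suc K))) = 0"
          by (simp_all add: g_def num_words_eq_0_of_gt K)
        then show ?thesis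
          using summation_by_parts[of "\<lambda>i. int (num_words N (Suc i))" g "Suc K"]
          unfolding lessThan_Suc_atMost by simp
      qed
      also have "\<dots> = (\<Sum>i\<le>K. int (num_words N (Suc (Suc i))) * int ((t + Suc (Suc i)) choose Suc t))"
        by (intro sum.cong) (auto simp: g_def)
      also have "\<dots> = (\<Sum>j\<le>N. int (num_words N j) * int ((t + j) choose Suc t))"
      proof -
        have "num_words (Suc (Suc K)) 1 = 0" by (rule num_words_single_zero) simp
        then show ?thesis
          unfolding K by (simp only: sum.atMost_Suc_shift) simp
      qed
      finally show ?thesis by simp
    qed
    finally show ?thesis by linarith
  qed
qed

section \<open>The closed form\<close>

text \<open>
  Both terms of the recurrence have \<open>2 * n - m\<close> smaller by one, so this is the induction measure
  and Pascal's rule performs the step. The boundary \<open>m = 1\<close> is the symmetry of the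
  binomial coefficients: the two terms are the central ones in an odd row.
\<close>

lemma num_words_ballot:
  assumes "2 \<le> n" "1 \<le> m" "m \<le> n"
  shows "int (num_words n m) =
    int ((2 * n - m - 2) choose (n - 2)) - int ((2 * n - m - 2) choose (n - 1))"
  using assms
proof (induction "2 * n - m - 2" arbitrary: n m rule: less_induct)
  case less
  consider "m = 1" | "m = n" | "2 \<le> m" "m < n" using less.prems by linarith
  then show ?case
  proof cases
    case 1
    have "(2 * n - 3) choose (n - 2) = (2 * n - 3) choose (n - 1)"
      using binomial_symmetric[of "n - 2" "2 * n - 3"] less.prems by simp
    moreover have "2 * n - m - 2 = 2 * n - 3" using 1 by simp
    ultimately show ?thesis using 1 less.prems num_words_single_zero[of n] by simp
  next
    case 2
    then show ?thesis using less.prems by (simp add: num_words_all_zeros mult_2)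
  next
    case 3
    then obtain p where p: "n = p + 3"
      by (metis add.commute le_Suc_ex less_eq_Suc_le numeral_3_eq_3 numeral_2_eq_2
          Suc_le_mono order_trans)
    define d where "d = 2 * n - m - 3"
    have d: "2 * n - m - 2 = Suc d" "2 * n - Suc m - 2 = d" "2 * (n - 1) - (m - 1) - 2 = d"
      using 3 by (auto simp: d_def)
    have "int (num_words n (Suc m)) = int (d choose (n - 2)) - int (d choose (n - 1))"
      using less.hyps[of n "Suc m"] 3 d by simp
    moreover have "int (num_words (n - 1) (m - 1)) = int (d choose (n - 3)) - int (d choose (n - 2))"
      using less.hyps[of "n - 1" "m - 1"] 3 d by (simp add: numeral_3_eq_3 numeral_2_eq_2)
    ultimately show ?thesis
      using num_words_recurrence[of n m] 3 unfolding d by (simp add: p numeral_2_eq_2)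
  qed
qed

theorem theorem2p4:
  fixes n m :: nat
  assumes "2 \<le> m" and "m \<le> n"
  shows "real (num_words n m) =
    (real m - 1) / (real n - 1) * real ((2 * n - m - 2) choose (n - 2))"
proof -
  define B where "B = (2 * n - m - 2) choose (n - 2)"
  define C where "C = (2 * n - m - 2) choose (n - 1)"
  have "real_of_int (int (num_words n m)) = real_of_int (int B - int C)"
    using num_words_ballot[of n m] assms by (simp add: B_def C_def)
  then have A: "real (num_words n m) = real B - real C" by simp
  have "Suc (n - 2) * ((2 * n - m - 2) choose Suc (n - 2))
      = (2 * n - m - 2 - (n - 2)) * ((2 * n - m - 2) choose (n - 2))"
    using binomial_absorb_comp[of "2 * n - m - 2" "n - 2"]
      binomial_absorption[of "n - 2" "2 * n - m - 2"] by simp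
  moreover have "Suc (n - 2) = n - 1" "2 * n - m - 2 - (n - 2) = n - m" using assms by auto
  ultimately have "(n - 1) * C = (n - m) * B" by (simp add: B_def C_def)
  then have "real (n - 1) * real C = real (n - m) * real B" by (metis of_nat_mult)
  then have "(real n - 1) * real C = (real n - real m) * real B"
    using assms by (simp add: of_nat_diff)
  then show ?thesis
    using assms unfolding A B_def[symmetric] by (simp add: field_simps)
qed

end
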